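(* Let $(f(i,j))_{i,j\in\mathbb{Z}}$ be independent and identically distributed $\mathbb{Z}\cup\{-\infty\}$-valued random variables on a probability space $(\Omega,\mathcal{F},\mathbb{P})$, and let $Z_0,Z_1,Z_2,\dots$ be independent random variables, each having the same distribution as $f(0,0)$. If $$\mathbb{E}\Big(\sup_{m\in\mathbb{N}_0}(Z_m-m)\Big)=\mathbb{E}\big(Z_0\vee(-1+Z_1)\vee(-2+Z_2)\vee\dots\big)>0,$$ then, almost surely, there exists a function $v:\mathbb{Z}\to\mathbb{N}_0$ such that $$\Delta_1 v(i)\le f(i,v(i))\quad\text{for all } i\in\mathbb{Z}.$$
   Context: $\mathbb{N}_0=\{0,1,2,\dots\}$ and $a\vee b=\max\{a,b\}$. For $v:\mathbb{Z}\to\mathbb{Z}$, the discrete Laplacian is $\Delta_1 v(i)=v(i+1)+v(i-1)-2v(i)$. $\mathbb{E}$ is the expected value of a (possibly extended real-valued) random variable, whenever it is defined. The usual order on $\mathbb{Z}\cup\{-\infty\}$ is used, so the inequality $\Delta_1 v(i)\le f(i,v(i))$ fails when $f(i,v(i))=-\infty$. The function $v$ is allowed to depend on the realization $\omega\in\Omega$. *)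

theory Defs
  imports "HOL-Probability.Probability"
begin

definition laplacian1 :: "(int \<Rightarrow> int) \<Rightarrow> int \<Rightarrow> int" where
  "laplacian1 v i = v (i + 1) + v (i - 1) - 2 * v i"

definition int_or_minf :: "ereal set" where
  "int_or_minf = insert (-\<infinity>) (range (\<lambda>k::int. ereal (real_of_int k)))"

text \<open>
  Expectation of an extended real-valued random variable, as the expectation of the positive part
  minus that of the negative part; \<^const>\<open>e2ennreal\<close> maps negative arguments to 0.
  It is defined iff at least one of the two parts has finite expectation. This has to be required
  separately, because \<open>\<infinity> - \<infinity> = \<infinity>\<close> holds in \<^typ>\<open>ereal\<close>.
\<close>

definition ereal_expectation_defined :: "'a measure \<Rightarrow> ('a \<Rightarrow> ereal) \<Rightarrow> bool" where
  "ereal_expectation_defined M X \<longleftrightarrow>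
     X \<in> borel_measurable M \<and>
     ((\<integral>\<^sup>+ x. e2ennreal (X x) \<partial>M) < \<infinity> \<or> (\<integral>\<^sup>+ x. e2ennreal (- X x) \<partial>M) < \<infinity>)"

definition ereal_expectation :: "'a measure \<Rightarrow> ('a \<Rightarrow> ereal) \<Rightarrow> ereal" where
  "ereal_expectation M X =
     enn2ereal (\<integral>\<^sup>+ x. e2ennreal (X x) \<partial>M) - enn2ereal (\<integral>\<^sup>+ x. e2ennreal (- X x) \<partial>M)"

end

theory Submission
  imports Defs
begin

text \<open>
  Going right from a height \<open>K\<close> at column \<open>0\<close>, let \<open>u\<close> be the largest height that the constraint at
  the previous column allows. Choosing \<open>u - m\<close> instead of \<open>u\<close> lowers the slope by \<open>m\<close>, and the
  constraint at the new column lets the slope grow by the field value there. Taking the best \<open>m\<close>, the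
  maximal slope is a random walk whose increments are independent copies of \<open>sup (Z\<^sub>m - m)\<close>, because
  \<open>u\<close> depends only on earlier columns. After truncating the field from above at some \<open>b\<close> the drift is
  still positive and the increments have exponential moments: the first \<open>m\<close> with \<open>Z\<^sub>m \<ge> 0\<close> is
  geometric. A Chernoff bound makes the slope exceed \<open>d n - c\<close> for all \<open>n\<close> except with probability
  \<open>O(exp (- s c))\<close>. The truncation bounds \<open>m\<close> by \<open>b\<close> minus the increment, so the height stays
  nonnegative once \<open>K \<ge> (c + b)\<^sup>2 / (2 d)\<close>. The left half-line is symmetric, and two half-lines
  starting with nonpositive slope at height \<open>K\<close> fit together if \<open>f(0, K) \<ge> 0\<close>. By Borel--Cantelli
  along a sequence of heights, almost surely some \<open>K\<close> satisfies all three requirements.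
\<close>

section \<open>The slope increment\<close>

text \<open>The cap \<open>b\<close> keeps the increment bounded above. It also limits the
  undershoot: where the supremum is attained at \<open>m\<close>, the value is at most
  \<open>b - m\<close>.\<close>

definition drift :: "real \<Rightarrow> (nat \<Rightarrow> ereal) \<Rightarrow> ereal" where
  "drift b z = (SUP m. min (z m) (ereal b) - ereal (real m))"

definition first_nonneg :: "(nat \<Rightarrow> ereal) \<Rightarrow> nat" where
  "first_nonneg z = (LEAST m. 0 \<le> z m)"

lemma drift_mono: "b \<le> b' \<Longrightarrow> drift b z \<le> drift b' z"
  unfolding drift_def by (intro SUP_mono' ereal_minus_mono min.mono) auto

lemma drift_le: "drift b z \<le> ereal b"
proof -
  have "min (z m) (ereal b) - ereal (real m) \<le> ereal b" for m
    by (cases "z m") (auto simp: min_def)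
  then show ?thesis unfolding drift_def by (auto intro: SUP_least)
qed

text \<open>The first nonnegative entry already contributes at least minus its index. All lower tail
  estimates for \<open>drift\<close> come from this bound.\<close>

lemma drift_ge:
  assumes "0 \<le> b" "\<exists>m. 0 \<le> z m"
  shows "- ereal (real (first_nonneg z)) \<le> drift b z"
proof -
  let ?G = "first_nonneg z"
  have "0 \<le> z ?G" unfolding first_nonneg_def using assms(2) by (rule LeastI_ex)
  then have "- ereal (real ?G) \<le> min (z ?G) (ereal b) - ereal (real ?G)"
    using assms(1) by (cases "z ?G") (auto simp: min_def)
  also have "\<dots> \<le> drift b z" unfolding drift_def by (rule SUP_upper) simp
  finally show ?thesis .
qed

lemma drift_finite:
  assumes "0 \<le> b" "\<exists>m. 0 \<le> z m"
  shows "drift b z = ereal (real_of_ereal (drift b z))"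
  using drift_le[of b z] drift_ge[OF assms] by (cases "drift b z") auto

text \<open>Removing the cap recovers the supremum whose expectation is assumed positive. This is
  what allows the drift to be approximated by truncation.\<close>

lemma SUP_drift: "(SUP k::nat. drift (real k) z) = (SUP m. z m - ereal (real m))"
proof (rule antisym)
  show "(SUP k::nat. drift (real k) z) \<le> (SUP m. z m - ereal (real m))"
    unfolding drift_def by (intro SUP_least SUP_mono' ereal_minus_mono) auto
  have "z m - ereal (real m) \<le> (SUP k::nat. drift (real k) z)" for m
  proof -
    have *: "min (z m) (ereal (real k)) - ereal (real m) \<le> (SUP k::nat. drift (real k) z)" for k
    proof -
      have "min (z m) (ereal (real k)) - ereal (real m) \<le> drift (real k) z"
        unfolding drift_def by (rule SUP_upper) simp
      also have "\<dots> \<le> (SUP k::nat. drift (real k) z)" by (rule SUP_upper) simp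
      finally show ?thesis .
    qed
    show ?thesis
    proof (cases "z m")
      case (real r)
      obtain k :: nat where "r \<le> real k" using real_arch_simple by blast
      then show ?thesis using *[of k] real by (simp add: min_def)
    next
      case PInf
      \<comment> \<open>Here \<open>z\<close> is an arbitrary extended real sequence. At an entry
        \<open>\<infinity>\<close> the truncated value is the cap itself, which is unbounded in
        \<open>k\<close>.\<close>
      have "(SUP k::nat. drift (real k) z) = \<infinity>"
      proof (rule ereal_top)
        fix B :: real
        obtain k :: nat where "B + real m \<le> real k" using real_arch_simple by blast
        then have "ereal B \<le> min (z m) (ereal (real k)) - ereal (real m)" using PInf by simp
        then show "ereal B \<le> (SUP k::nat. drift (real k) z)" using * order_trans by blast
      qed
      then show ?thesis by simp
    qed simp
  qed
  then show "(SUP m. z m - ereal (real m)) \<le> (SUP k::nat. drift (real k) z)"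
    by (rule SUP_least)
qed

text \<open>With an integer cap every term is an integer or \<open>-\<infinity>\<close>, so a finite
  supremum of such terms is a maximum and is itself an integer.\<close>

lemma drift_attained:
  assumes "0 \<le> b" "b \<in> \<int>" "\<exists>m. 0 \<le> z m" "\<And>m. z m \<in> int_or_minf"
  obtains m where "drift b z = min (z m) (ereal b) - ereal (real m)"
    "real_of_ereal (drift b z) \<in> \<int>"
proof -
  let ?d = "real_of_ereal (drift b z)"
  have d: "drift b z = ereal ?d" by (rule drift_finite[OF assms(1,3)])
  \<comment> \<open>A term less than 1 below the supremum cannot be exceeded by another integer
    term.\<close>
  have "ereal (?d - 1) < drift b z" by (subst d) simp
  then obtain m where m: "ereal (?d - 1) < min (z m) (ereal b) - ereal (real m)"
    unfolding drift_def less_SUP_iff by auto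
  have up: "min (z m') (ereal b) - ereal (real m') \<le> ereal ?d" for m'
    using SUP_upper[of m' UNIV "\<lambda>m. min (z m) (ereal b) - ereal (real m)"] d
    by (simp add: drift_def)
  have int: "\<exists>k::int. min (z m') (ereal b) - ereal (real m') = ereal (real_of_int k) \<or>
     min (z m') (ereal b) - ereal (real m') = -\<infinity>" for m'
  proof -
    obtain c where c: "b = real_of_int c" using assms(2) by (auto elim: Ints_cases)
    consider "z m' = -\<infinity>" | k where "z m' = ereal (real_of_int k)"
      using assms(4)[of m'] by (auto simp: int_or_minf_def)
    then show ?thesis
    proof cases
      case 1 then show ?thesis by simp
    next
      case (2 k)
      then have "min (z m') (ereal b) - ereal (real m') = ereal (real_of_int (min k c - int m'))"
        using c by (simp add: min_def)
      then show ?thesis by blast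
    qed
  qed
  obtain k :: int where k: "min (z m) (ereal b) - ereal (real m) = ereal (real_of_int k)"
    using int[of m] m by auto
  have "min (z m') (ereal b) - ereal (real m') \<le> ereal (real_of_int k)" for m'
  proof -
    consider k' :: int where "min (z m') (ereal b) - ereal (real m') = ereal (real_of_int k')"
      | "min (z m') (ereal b) - ereal (real m') = -\<infinity>" using int[of m'] by blast
    then show ?thesis
    proof cases
      case (1 k')
      then have "real_of_int k' \<le> ?d" using up[of m'] by simp
      moreover have "?d - 1 < real_of_int k" using m k by simp
      ultimately have "k' < k + 1" by linarith
      then show ?thesis using 1 by simp
    qed simp
  qed
  then have "drift b z \<le> ereal (real_of_int k)" unfolding drift_def by (rule SUP_least)
  moreover have "ereal (real_of_int k) \<le> drift b z" using up[of m] k d by simp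
  ultimately have "drift b z = ereal (real_of_int k)" by simp
  then show ?thesis using that[of m] k by simp
qed

section \<open>Cancellation in \<open>ennreal\<close> and the Laplace transform near 0\<close>

text \<open>If \<open>y \<le> h\<close>, then \<open>y + c \<le> h + c < h + a \<le> y + c\<close>;
  finiteness of \<open>h\<close> gives the strict step. It replaces subtraction when positive and
  negative parts are compared.\<close>

lemma ennreal_less_if_add_le:
  fixes a c h y :: ennreal
  assumes "a + h \<le> y + c" "c < a" "h < \<infinity>"
  shows "h < y"
proof (rule ccontr)
  assume "\<not> h < y"
  then have "y + c \<le> h + c" by (intro add_right_mono) simp
  also have "h + c < h + a" using assms(2,3) unfolding ennreal_add_left_cancel_less by auto
  also have "h + a \<le> y + c" using assms(1) by (simp only: add.commute)
  finally show False by simp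
qed

text \<open>Convexity of \<open>exp (- s * Y)\<close> in \<open>s\<close> supplies the dominating function for
  differentiating the Laplace transform at \<open>0\<close>.\<close>

lemma (in prob_space) exp_moment_less_1:
  fixes Y :: "'a \<Rightarrow> real"
  assumes Y: "integrable M Y" "0 < expectation Y"
    and e: "integrable M (\<lambda>x. exp (- t * Y x))" "0 < t"
  shows "\<exists>s>0. integrable M (\<lambda>x. exp (- s * Y x)) \<and> expectation (\<lambda>x. exp (- s * Y x)) < 1"
proof -
  define s where "s n = t / real (Suc n)" for n
  have s: "0 < s n" "s n \<le> t" for n using e(2) by (auto simp: s_def field_simps)
  \<comment> \<open>The difference quotient at 0 of the integrand of the Laplace transform, taken
    along \<open>s n\<close>, which tends to 0 within \<open>(0, t]\<close>.\<close>
  define g where "g n x = (exp (- s n * Y x) - 1) / s n" for n x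
  have [measurable]: "Y \<in> borel_measurable M" using Y by auto
  have [measurable]: "g n \<in> borel_measurable M" for n unfolding g_def[abs_def] by measurable
  have bound: "norm (g n x) \<le> \<bar>Y x\<bar> + (exp (- t * Y x) + 1) / t" for n x
  proof -
    have c: "s n / t \<in> {0..1}" using s[of n] e(2) by (simp add: field_simps)
    have "exp ((1 - s n / t) *\<^sub>R 0 + (s n / t) *\<^sub>R (- t * Y x)) \<le>
       (1 - s n / t) * exp 0 + (s n / t) * exp (- t * Y x)"
      by (rule convex_onD[OF exp_convex]) (use c in auto)
    moreover have "(1 - s n / t) *\<^sub>R 0 + (s n / t) *\<^sub>R (- t * Y x) = - s n * Y x"
      using e(2) by simp
    ultimately have "exp (- s n * Y x) - 1 \<le> s n * ((exp (- t * Y x) - 1) / t)"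
      by (simp add: algebra_simps diff_divide_distrib)
    then have "g n x \<le> (exp (- t * Y x) - 1) / t"
      using s[of n] by (simp add: g_def field_simps)
    moreover have "- Y x \<le> g n x"
      using exp_ge_add_one_self[of "- s n * Y x"] s[of n] by (simp add: g_def field_simps)
    moreover have "(exp (- t * Y x) - 1) / t \<le> (exp (- t * Y x) + 1) / t"
      using e(2) by (simp add: divide_right_mono)
    moreover have "0 \<le> (exp (- t * Y x) + 1) / t" using e(2) by (simp add: add_nonneg_nonneg)
    ultimately show ?thesis unfolding real_norm_def by linarith
  qed
  have lim: "(\<lambda>n. g n x) \<longlonglongrightarrow> - Y x" for x
  proof -
    have "((\<lambda>h. exp (- h * Y x)) has_real_derivative (- Y x)) (at 0)"
      by (auto intro!: derivative_eq_intros)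
    then have "((\<lambda>h. (exp (- h * Y x) - 1) / h) \<longlongrightarrow> - Y x) (at 0)"
      by (simp add: has_field_derivative_iff)
    moreover have "filterlim s (at 0) sequentially"
    proof -
      have "s \<longlonglongrightarrow> 0" unfolding s_def
        using LIMSEQ_Suc[OF lim_const_over_n[of t]] by simp
      then show ?thesis unfolding filterlim_at
        using s by (auto intro!: always_eventually simp: less_imp_neq[symmetric])
    qed
    ultimately show ?thesis unfolding g_def by (rule filterlim_compose[of "\<lambda>h. (exp (- h * Y x) - 1) / h"])
  qed
  \<comment> \<open>The limit is minus the mean of \<open>Y\<close>, hence negative. A negative mean
    quotient at some \<open>s n\<close> puts the transform below its value 1 at 0.\<close>
  have "(\<lambda>n. expectation (g n)) \<longlonglongrightarrow> expectation (\<lambda>x. - Y x)"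
  proof (rule integral_dominated_convergence[where w="\<lambda>x. \<bar>Y x\<bar> + (exp (- t * Y x) + 1) / t"])
    show "integrable M (\<lambda>x. \<bar>Y x\<bar> + (exp (- t * Y x) + 1) / t)" using Y e by auto
  qed (use lim bound in auto)
  then have "\<forall>\<^sub>F n in sequentially. expectation (g n) < 0"
    using Y by (intro order_tendstoD(2)[where y="expectation (\<lambda>x. - Y x)"]) auto
  then obtain n where n: "expectation (g n) < 0" by (auto simp: eventually_sequentially)
  have ig: "integrable M (g n)"
    by (rule Bochner_Integration.integrable_bound[where f="\<lambda>x. \<bar>Y x\<bar> + (exp (- t * Y x) + 1) / t"])
       (use Y e bound[of n] in \<open>auto simp: g_def intro: order_trans[OF _ abs_ge_self]\<close>)
  have eq: "exp (- s n * Y x) = 1 + s n * g n x" for x using s[of n] by (simp add: g_def)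
  have "integrable M (\<lambda>x. exp (- s n * Y x))" unfolding eq using ig by auto
  moreover have "expectation (\<lambda>x. exp (- s n * Y x)) = 1 + s n * expectation (g n)"
    unfolding eq using ig by (subst Bochner_Integration.integral_add) (auto simp: prob_space)
  moreover have "s n * expectation (g n) < 0" using s[of n] n by (simp add: mult_pos_neg)
  ultimately show ?thesis using s[of n] by (intro exI[of _ "s n"]) auto
qed

section \<open>Moments of the slope increment\<close>

text \<open>\<open>D\<close> is the law of a single field value. A nonnegative value must have
  positive probability, since otherwise the supremum in the hypothesis would be almost surely at
  most 0.\<close>

locale obstacle_law = prob_space D for D :: "ereal measure" +
  assumes sets_D [measurable_cong]: "sets D = sets borel"
    and nonneg_pos: "prob {..<0} < 1"
begin

abbreviation column :: "(nat \<Rightarrow> ereal) measure" where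
  "column \<equiv> Pi\<^sub>M UNIV (\<lambda>_. D)"

sublocale column: product_prob_space "\<lambda>_. D" "UNIV :: nat set"
  by unfold_locales

lemma measurable_coord [measurable]: "(\<lambda>z. z m) \<in> borel_measurable column"
proof -
  have "(\<lambda>z. z m) \<in> measurable column D" by measurable
  then show ?thesis by (simp add: measurable_cong_sets[OF refl sets_D])
qed

lemma measurable_drift [measurable]: "drift b \<in> borel_measurable column"
  unfolding drift_def[abs_def] by measurable

lemma measurable_first_nonneg [measurable]: "first_nonneg \<in> measurable column (count_space UNIV)"
  unfolding first_nonneg_def[abs_def] by measurable

text \<open>This is the geometric tail of \<open>first_nonneg\<close>: up to the null set where
  every entry is negative, the event says that \<open>first_nonneg\<close> is at least
  \<open>m\<close>.\<close>

lemma prob_all_neg: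
  "measure column {z \<in> space column. \<forall>j<m. z j < 0} = prob {..<0} ^ m"
proof -
  have "emeasure column {z \<in> space column. \<forall>j\<in>{..<m}. z j \<in> {..<0}} = (\<Prod>j<m. emeasure D {..<0})"
    by (rule column.emeasure_PiM_Collect) (auto simp: sets_D)
  then have "emeasure column {z \<in> space column. \<forall>j<m. z j < 0} = ennreal (prob {..<0} ^ m)"
    by (simp add: emeasure_eq_measure ennreal_power Ball_def)
  then show ?thesis by (simp add: measure_def)
qed

lemma AE_nonneg: "AE z in column. \<exists>m. 0 \<le> z m"
proof -
  let ?N = "{z \<in> space column. \<forall>j. z j < 0}"
  have "measure column ?N \<le> prob {..<0} ^ m" for m
    unfolding prob_all_neg[symmetric] by (rule column.P.finite_measure_mono) auto
  moreover have "(\<lambda>m. prob {..<0} ^ m) \<longlonglongrightarrow> 0"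
    using nonneg_pos by (intro LIMSEQ_realpow_zero) auto
  ultimately have "measure column ?N \<le> 0" by (intro LIMSEQ_le_const) auto
  then have "emeasure column ?N = 0" by (simp add: column.P.emeasure_eq_measure measure_le_0_iff)
  then show ?thesis
    by (intro AE_I[where N="?N"]) (auto simp: not_le)
qed

text \<open>The tail decays like the powers of \<open>q = prob {..<0}\<close>, so any
  \<open>r > 1\<close> with \<open>r * q < 1\<close> leads to a convergent geometric series.\<close>

lemma integrable_power_first_nonneg:
  obtains r :: real where "1 < r" "integrable column (\<lambda>z. r ^ first_nonneg z)"
proof -
  let ?q = "prob {..<0}"
  obtain r where r: "1 < r" "r * ?q < 1"
  proof (cases "?q = 0")
    case True then show ?thesis using that[of 2] by simp
  next
    case False
    then have q: "0 < ?q" using measure_nonneg[of D "{..<0}"] by linarith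
    then have "1 < 1 / ?q" using nonneg_pos by (simp add: field_simps)
    then obtain r where "1 < r" "r < 1 / ?q" using dense by blast
    then show ?thesis using that[of r] q by (simp add: field_simps)
  qed
  \<comment> \<open>The summand with \<open>m = first_nonneg z\<close> alone equals the left
    integrand; the full sum integrates term by term.\<close>
  have "(\<integral>\<^sup>+ z. ennreal (r ^ first_nonneg z) \<partial>column) \<le>
      (\<integral>\<^sup>+ z. (\<Sum>m. ennreal (r ^ m) * indicator {z \<in> space column. \<forall>j<m. z j < 0} z) \<partial>column)"
  proof (rule nn_integral_mono)
    fix z assume z: "z \<in> space column"
    have "\<forall>j<first_nonneg z. z j < 0"
      unfolding first_nonneg_def using not_less_Least not_le by blast
    then have "ennreal (r ^ first_nonneg z) = (\<Sum>m\<in>{first_nonneg z}.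
        ennreal (r ^ m) * indicator {z \<in> space column. \<forall>j<m. z j < 0} z)"
      using z by simp
    also have "\<dots> \<le> (\<Sum>m. ennreal (r ^ m) * indicator {z \<in> space column. \<forall>j<m. z j < 0} z)"
      by (rule sum_le_suminf) auto
    finally show "ennreal (r ^ first_nonneg z) \<le>
      (\<Sum>m. ennreal (r ^ m) * indicator {z \<in> space column. \<forall>j<m. z j < 0} z)" .
  qed
  also have "\<dots> = (\<Sum>m. ennreal (r ^ m) * emeasure column {z \<in> space column. \<forall>j<m. z j < 0})"
    by (subst nn_integral_suminf) (auto simp: nn_integral_cmult_indicator)
  also have "\<dots> = (\<Sum>m. ennreal ((r * ?q) ^ m))"
    using r by (simp add: column.P.emeasure_eq_measure prob_all_neg power_mult_distrib ennreal_mult)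
  also have "\<dots> < \<infinity>"
    using r by (subst suminf_ennreal2) (auto intro!: summable_geometric)
  finally have "integrable column (\<lambda>z. r ^ first_nonneg z)"
    using r by (intro integrableI_nonneg) auto
  then show ?thesis using that r by blast
qed

lemma integrable_first_nonneg: "integrable column (\<lambda>z. real (first_nonneg z))"
proof -
  obtain r :: real where r: "1 < r" "integrable column (\<lambda>z. r ^ first_nonneg z)"
    by (rule integrable_power_first_nonneg)
  show ?thesis
  proof (rule Bochner_Integration.integrable_bound[where f="\<lambda>z. r ^ first_nonneg z / (r - 1)"])
    have "real n \<le> r ^ n / (r - 1)" for n
      using Bernoulli_inequality[of "r - 1" n] r(1) by (simp add: field_simps)
    then show "AE z in column. norm (real (first_nonneg z)) \<le> norm (r ^ first_nonneg z / (r - 1))"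
      using r(1) by simp
  qed (use r in auto)
qed

lemma integrable_drift:
  assumes "0 \<le> b"
  shows "integrable column (\<lambda>z. real_of_ereal (drift b z))"
proof (rule Bochner_Integration.integrable_bound[where f="\<lambda>z. b + real (first_nonneg z)"])
  show "AE z in column. norm (real_of_ereal (drift b z)) \<le> norm (b + real (first_nonneg z))"
    using AE_nonneg
  proof eventually_elim
    case (elim z)
    show ?case
      using drift_le[of b z] drift_ge[OF assms elim] drift_finite[OF assms elim] assms
      by (cases "drift b z") auto
  qed
qed (use integrable_first_nonneg in auto)

text \<open>With \<open>t = ln r\<close> the lower bound on \<open>drift\<close> turns the
  exponential into at most a constant times \<open>r ^ first_nonneg z\<close>. One \<open>t\<close>
  serves every shift \<open>d\<close>.\<close>

lemma integrable_exp_drift: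
  assumes "0 \<le> b"
  obtains t where "0 < t" "\<And>d. integrable column (\<lambda>z. exp (- t * (real_of_ereal (drift b z) - d)))"
proof -
  obtain r :: real where r: "1 < r" "integrable column (\<lambda>z. r ^ first_nonneg z)"
    by (rule integrable_power_first_nonneg)
  have "integrable column (\<lambda>z. exp (- ln r * (real_of_ereal (drift b z) - d)))" for d
  proof (rule Bochner_Integration.integrable_bound[where f="\<lambda>z. exp (ln r * d) * r ^ first_nonneg z"])
    show "AE z in column. norm (exp (- ln r * (real_of_ereal (drift b z) - d)))
        \<le> norm (exp (ln r * d) * r ^ first_nonneg z)"
      using AE_nonneg
    proof eventually_elim
      case (elim z)
      have "- real (first_nonneg z) \<le> real_of_ereal (drift b z)"
        using drift_ge[OF assms elim] drift_finite[OF assms elim] by (cases "drift b z") auto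
      then have "ln r * (- real (first_nonneg z)) \<le> ln r * real_of_ereal (drift b z)"
        using r(1) by (intro mult_left_mono) auto
      then have "- ln r * (real_of_ereal (drift b z) - d) \<le> ln r * d + real (first_nonneg z) * ln r"
        by (simp add: algebra_simps)
      then have "exp (- ln r * (real_of_ereal (drift b z) - d)) \<le> exp (ln r * d + real (first_nonneg z) * ln r)"
        by simp
      also have "\<dots> = exp (ln r * d) * r ^ first_nonneg z"
        using r(1) by (simp add: exp_add exp_of_nat_mult)
      finally show ?case using r(1) by simp
    qed
  qed (use r in auto)
  then show ?thesis using that[of "ln r"] r(1) by simp
qed

text \<open>The hypothesis is positivity of the mean, stated without subtraction. Adding
  \<open>H\<close>, the integrable index \<open>first_nonneg\<close>, makes the truncated increments
  nonnegative almost everywhere; monotone convergence as the cap grows then finds a finite cap with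
  positive mean.\<close>

lemma ex_drift_expectation_pos:
  assumes pos: "(\<integral>\<^sup>+ z. e2ennreal (- (SUP m. z m - ereal (real m))) \<partial>column)
       < (\<integral>\<^sup>+ z. e2ennreal (SUP m. z m - ereal (real m)) \<partial>column)"
  shows "\<exists>b::nat. 0 < (\<integral> z. real_of_ereal (drift (real b) z) \<partial>column)"
proof -
  define X where "X z = (SUP m. z m - ereal (real m))" for z :: "nat \<Rightarrow> ereal"
  define H where "H z = ereal (real (first_nonneg z))" for z
  have [measurable]: "X \<in> borel_measurable column" unfolding X_def[abs_def] by measurable
  have [measurable]: "H \<in> borel_measurable column" unfolding H_def[abs_def] by measurable
  have eH: "e2ennreal (H z) = ennreal (real (first_nonneg z))" for z by (simp add: H_def)
  have finH: "(\<integral>\<^sup>+ z. e2ennreal (H z) \<partial>column) < \<infinity>"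
    unfolding eH using integrable_first_nonneg
    by (subst nn_integral_eq_integral) auto
  \<comment> \<open>A rearrangement of \<open>X + H \<le> (X + H)\<^sup>+\<close> with
    \<open>X\<close> split into its parts, valid also for infinite \<open>X\<close>.\<close>
  have "e2ennreal (X z) + e2ennreal (H z) \<le> e2ennreal (X z + H z) + e2ennreal (- X z)" for z
  proof (cases "X z")
    case (real x)
    show ?thesis
    proof (cases "0 \<le> x")
      case True then show ?thesis using real by (simp add: H_def ennreal_plus[symmetric] del: ennreal_plus)
    next
      case False
      then have "ennreal x = 0" by (simp add: ennreal_neg)
      moreover have "ennreal (real (first_nonneg z)) \<le> ennreal (x + real (first_nonneg z)) + ennreal (- x)"
      proof (cases "0 \<le> x + real (first_nonneg z)")
        case True
        then show ?thesis using False by (subst ennreal_plus[symmetric]) auto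
      next
        case F: False
        then have "ennreal (real (first_nonneg z)) \<le> ennreal (- x)" by (intro ennreal_leI) simp
        then show ?thesis using F by (simp add: ennreal_neg)
      qed
      ultimately show ?thesis using real by (simp add: H_def)
    qed
  next
    case PInf then show ?thesis by (simp add: H_def)
  next
    case MInf then show ?thesis by (simp add: H_def)
  qed
  then have "(\<integral>\<^sup>+ z. e2ennreal (X z) + e2ennreal (H z) \<partial>column)
     \<le> (\<integral>\<^sup>+ z. e2ennreal (X z + H z) + e2ennreal (- X z) \<partial>column)"
    by (intro nn_integral_mono) auto
  then have le: "(\<integral>\<^sup>+ z. e2ennreal (X z) \<partial>column) + (\<integral>\<^sup>+ z. e2ennreal (H z) \<partial>column)
     \<le> (\<integral>\<^sup>+ z. e2ennreal (X z + H z) \<partial>column) + (\<integral>\<^sup>+ z. e2ennreal (- X z) \<partial>column)"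
    by (simp add: nn_integral_add)
  have "(\<integral>\<^sup>+ z. e2ennreal (H z) \<partial>column) < (\<integral>\<^sup>+ z. e2ennreal (X z + H z) \<partial>column)"
    using le pos[folded X_def] finH by (rule ennreal_less_if_add_le)
  also have "(\<integral>\<^sup>+ z. e2ennreal (X z + H z) \<partial>column)
     = (\<integral>\<^sup>+ z. (SUP k::nat. e2ennreal (drift (real k) z + H z)) \<partial>column)"
  proof (rule nn_integral_cong)
    fix z :: "nat \<Rightarrow> ereal"
    have inc: "incseq (\<lambda>k::nat. drift (real k) z + H z)"
      by (auto simp: incseq_def intro!: add_right_mono drift_mono)
    have "X z + H z = (SUP k::nat. drift (real k) z) + H z" unfolding X_def SUP_drift ..
    also have "\<dots> = (SUP k::nat. drift (real k) z + H z)"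
      by (subst SUP_ereal_add_left) (auto simp: H_def)
    finally have eq: "X z + H z = (SUP k::nat. drift (real k) z + H z)" .
    have "sup_continuous e2ennreal" by (rule sup_continuous_e2ennreal) (simp add: sup_continuous_id)
    then show "e2ennreal (X z + H z) = (SUP k::nat. e2ennreal (drift (real k) z + H z))"
      unfolding eq by (rule sup_continuousD[OF _ inc[unfolded mono_def[symmetric]], unfolded image_comp comp_def])
  qed
  also have "\<dots> = (SUP k::nat. (\<integral>\<^sup>+ z. e2ennreal (drift (real k) z + H z) \<partial>column))"
    by (rule nn_integral_monotone_convergence_SUP)
       (auto simp: incseq_def le_fun_def intro!: e2ennreal_mono add_right_mono drift_mono)
  finally obtain b :: nat where b:
    "(\<integral>\<^sup>+ z. e2ennreal (H z) \<partial>column) < (\<integral>\<^sup>+ z. e2ennreal (drift (real b) z + H z) \<partial>column)"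
    by (auto simp: less_SUP_iff)
  define d where "d z = real_of_ereal (drift (real b) z)" for z
  have id: "integrable column d" unfolding d_def[abs_def] by (rule integrable_drift) simp
  \<comment> \<open>Almost everywhere the positive part is the sum itself, so the comparison becomes
    one of real integrals and the mean of \<open>first_nonneg\<close> cancels.\<close>
  have ae: "AE z in column. 0 \<le> d z + real (first_nonneg z) \<and>
      e2ennreal (drift (real b) z + H z) = ennreal (d z + real (first_nonneg z))"
    using AE_nonneg
  proof eventually_elim
    case (elim z)
    then show ?case
      using drift_ge[of "real b" z] drift_finite[of "real b" z]
      by (cases "drift (real b) z") (auto simp: d_def H_def)
  qed
  have "(\<integral>\<^sup>+ z. e2ennreal (drift (real b) z + H z) \<partial>column)
      = (\<integral>\<^sup>+ z. ennreal (d z + real (first_nonneg z)) \<partial>column)"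
    by (rule nn_integral_cong_AE) (use ae in auto)
  also have "\<dots> = ennreal (\<integral> z. d z + real (first_nonneg z) \<partial>column)"
    by (rule nn_integral_eq_integral) (use ae id integrable_first_nonneg in auto)
  finally have "ennreal (\<integral> z. real (first_nonneg z) \<partial>column)
      < ennreal (\<integral> z. d z + real (first_nonneg z) \<partial>column)"
    using b unfolding eH using integrable_first_nonneg by (subst (asm) nn_integral_eq_integral) auto
  then have "(\<integral> z. real (first_nonneg z) \<partial>column) < (\<integral> z. d z + real (first_nonneg z) \<partial>column)"
    by (simp add: ennreal_less_iff)
  then have "0 < (\<integral> z. d z \<partial>column)" using id integrable_first_nonneg by simp
  then show ?thesis unfolding d_def by blast
qed

lemma ex_exp_drift_less_1:
  assumes "(\<integral>\<^sup>+ z. e2ennreal (- (SUP m. z m - ereal (real m))) \<partial>column)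
       < (\<integral>\<^sup>+ z. e2ennreal (SUP m. z m - ereal (real m)) \<partial>column)"
  shows "\<exists>(b::nat) d s k. 0 < d \<and> 0 < s \<and> 0 \<le> k \<and> k < 1 \<and>
     (\<integral>\<^sup>+ z. ennreal (exp (- s * (real_of_ereal (drift (real b) z) - d))) \<partial>column) = ennreal k"
proof -
  obtain b :: nat where b: "0 < (\<integral> z. real_of_ereal (drift (real b) z) \<partial>column)"
    using ex_drift_expectation_pos[OF assms] by blast
  \<comment> \<open>Half of the mean drift: the increment minus \<open>d\<close> still has positive
    mean, and \<open>d\<close> becomes the guaranteed growth rate of the slope.\<close>
  define d where "d = (\<integral> z. real_of_ereal (drift (real b) z) \<partial>column) / 2"
  obtain t where t: "0 < t" "\<And>d. integrable column (\<lambda>z. exp (- t * (real_of_ereal (drift (real b) z) - d)))"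
    using integrable_exp_drift[of "real b"] by auto
  have i: "integrable column (\<lambda>z. real_of_ereal (drift (real b) z))"
    by (rule integrable_drift) simp
  have "0 < (\<integral> z. real_of_ereal (drift (real b) z) - d \<partial>column)"
    using i b by (simp add: d_def column.P.prob_space)
  with i t obtain s where s: "0 < s"
    "integrable column (\<lambda>z. exp (- s * (real_of_ereal (drift (real b) z) - d)))"
    "(\<integral> z. exp (- s * (real_of_ereal (drift (real b) z) - d)) \<partial>column) < 1"
    using column.P.exp_moment_less_1[of "\<lambda>z. real_of_ereal (drift (real b) z) - d" t] by auto
  have "(\<integral>\<^sup>+ z. ennreal (exp (- s * (real_of_ereal (drift (real b) z) - d))) \<partial>column) =
      ennreal (\<integral> z. exp (- s * (real_of_ereal (drift (real b) z) - d)) \<partial>column)"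
    using s(2) by (rule nn_integral_eq_integral) simp
  moreover have "0 \<le> (\<integral> z. exp (- s * (real_of_ereal (drift (real b) z) - d)) \<partial>column)"
    by (rule Bochner_Integration.integral_nonneg) simp
  moreover have "0 < d" using b by (simp add: d_def)
  ultimately show ?thesis using s(1,3) by blast
qed

text \<open>Transfers facts about \<open>column\<close> to concrete sequences: the
  \<open>Z m\<close>, a column read downwards, and column 0 at selected heights.\<close>

lemma iid_sequence:
  assumes "prob_space M" "prob_space.indep_vars M (\<lambda>_. borel) X (UNIV :: nat set)"
    and "\<And>m. distr M borel (X m) = D"
  shows iid_sequence_measurable: "(\<lambda>\<omega> m. X m \<omega>) \<in> measurable M column"
    and distr_iid_sequence: "distr M column (\<lambda>\<omega> m. X m \<omega>) = column"
proof -
  interpret M: prob_space M by fact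
  have [measurable]: "X m \<in> borel_measurable M" for m
    using assms(2) unfolding M.indep_vars_def by blast
  have sets: "sets (Pi\<^sub>M UNIV (\<lambda>_::nat. borel :: ereal measure)) = sets column"
    by (intro sets_PiM_cong) (auto simp: sets_D)
  have "(\<lambda>\<omega> m. X m \<omega>) \<in> measurable M (Pi\<^sub>M UNIV (\<lambda>_. borel))"
    by (rule measurable_PiM_single') auto
  then show "(\<lambda>\<omega> m. X m \<omega>) \<in> measurable M column"
    using sets by (simp cong: measurable_cong_sets)
  have "distr M (Pi\<^sub>M UNIV (\<lambda>_. borel)) (\<lambda>\<omega>. \<lambda>m\<in>UNIV. X m \<omega>) = Pi\<^sub>M UNIV (\<lambda>m. distr M borel (X m))"
    using assms(2) by (subst (asm) M.indep_vars_iff_distr_eq_PiM) auto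
  then show "distr M column (\<lambda>\<omega> m. X m \<omega>) = column"
    using sets by (simp add: assms(3) restrict_UNIV cong: distr_cong)
qed

lemma iid_sequence_AE_nonneg:
  assumes "prob_space M" "prob_space.indep_vars M (\<lambda>_. borel) X (UNIV :: nat set)"
    and "\<And>m. distr M borel (X m) = D"
  shows "AE \<omega> in M. \<exists>m. 0 \<le> X m \<omega>"
  by (rule AE_distrD[OF iid_sequence_measurable[OF assms]])
     (simp only: distr_iid_sequence[OF assms] AE_nonneg)

end

section \<open>The slope walk\<close>

lemma (in prob_space) indep_vars_reindex_inj:
  assumes indep: "indep_vars (\<lambda>_. N) X UNIV" and inj: "inj h"
  shows "indep_vars (\<lambda>_. N) (\<lambda>j. X (h j)) UNIV"
proof -
  let ?S = "\<lambda>i. sigma_sets (space M) {X i -` A \<inter> space M |A. A \<in> sets N}"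
  have rv: "\<And>i. random_variable N (X i)" and S: "indep_sets ?S UNIV"
    using indep by (auto simp: indep_vars_def)
  have "indep_sets (\<lambda>j. ?S (h j)) UNIV"
  proof (rule indep_setsI)
    show "?S (h j) \<subseteq> events" for j using S by (auto simp: indep_sets_def)
    fix A J assume J: "J \<noteq> {}" "J \<subseteq> UNIV" "finite J" "\<forall>j\<in>J. A j \<in> ?S (h j)"
    have "prob (\<Inter>i\<in>h ` J. A (inv h i)) = (\<Prod>i\<in>h ` J. prob (A (inv h i)))"
      by (rule indep_setsD[OF S]) (use J inj in \<open>auto simp: inv_f_f\<close>)
    then show "prob (\<Inter>j\<in>J. A j) = (\<Prod>j\<in>J. prob (A j))"
      using inj by (subst (asm) prod.reindex) (auto simp: inv_f_f inj_on_def inj_def)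
  qed
  then show ?thesis using rv by (simp add: indep_vars_def)
qed

text \<open>Choosing the least maximiser makes the undershoot a measurable function of the
  field.\<close>

definition argdrift :: "real \<Rightarrow> (nat \<Rightarrow> ereal) \<Rightarrow> nat" where
  "argdrift b z = (LEAST m. drift b z = min (z m) (ereal b) - ereal (real m))"

definition downward :: "(nat \<times> int \<Rightarrow> ereal) \<Rightarrow> nat \<Rightarrow> int \<Rightarrow> nat \<Rightarrow> ereal" where
  "downward g i u m = g (i, u - int m)"

text \<open>A state \<open>(w, s)\<close> records the height \<open>w\<close> in the current column and the largest slope \<open>s\<close>
  allowed towards the next one. Undershooting the maximal height \<open>u = w + s\<close> by \<open>m\<close> costs \<open>m\<close> in
  slope and gains the value of the field at \<open>u - m\<close>.\<close>

fun walk :: "real \<Rightarrow> (nat \<times> int \<Rightarrow> ereal) \<Rightarrow> int \<Rightarrow> nat \<Rightarrow> int \<times> int" where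
  "walk b g K 0 = (K, 0)"
| "walk b g K (Suc n) =
    (let (w, s) = walk b g K n; z = downward g n (w + s)
     in (w + s - int (argdrift b z), s + \<lfloor>real_of_ereal (drift b z)\<rfloor>))"

text \<open>The first \<open>n\<close> steps read only columns below \<open>n\<close>; hence the
  height at which column \<open>n\<close> is entered is independent of that column.\<close>

lemma walk_cong:
  assumes "\<And>i j. i < n \<Longrightarrow> g (i, j) = g' (i, j)"
  shows "walk b g K n = walk b g' K n"
  using assms
proof (induction n)
  case (Suc n)
  then have "downward g n = downward g' n" by (auto simp: downward_def fun_eq_iff)
  with Suc show ?case by (simp del: split_paired_All)
qed simp

text \<open>At the maximiser \<open>m\<close> with slope increment \<open>k\<close>, the sum
  \<open>k + m\<close> equals \<open>min (z m) b\<close>. The cap gives the second claim and the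
  field value at the new height the third.\<close>

lemma walk_step:
  fixes b :: nat
  assumes val: "\<And>p. g p \<in> int_or_minf" and ex: "\<And>i u. \<exists>m. 0 \<le> downward g i u m"
  obtains m :: nat where "fst (walk b g K (Suc n)) = fst (walk b g K n) + snd (walk b g K n) - int m"
    "snd (walk b g K (Suc n)) - snd (walk b g K n) + int m \<le> int b"
    "ereal (real_of_int (snd (walk b g K (Suc n)) - snd (walk b g K n) + int m))
       \<le> g (n, fst (walk b g K (Suc n)))"
proof -
  define w where "w = fst (walk b g K n)"
  define s where "s = snd (walk b g K n)"
  define z where "z = downward g n (w + s)"
  define m where "m = argdrift (real b) z"
  have ws: "walk b g K n = (w, s)" by (simp add: w_def s_def)
  have step: "walk b g K (Suc n) = (w + s - int m, s + \<lfloor>real_of_ereal (drift b z)\<rfloor>)"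
    by (simp add: ws z_def m_def Let_def)
  have ez: "\<exists>m. 0 \<le> z m" using ex by (simp add: z_def)
  have vz: "z m' \<in> int_or_minf" for m' using val by (simp add: z_def downward_def)
  obtain m0 where m0: "drift b z = min (z m0) (ereal b) - ereal (real m0)"
    "real_of_ereal (drift b z) \<in> \<int>"
    by (rule drift_attained[of "real b" z]) (use ez vz in auto)
  have att: "drift b z = min (z m) (ereal b) - ereal (real m)"
    unfolding m_def argdrift_def using m0(1) by (rule LeastI)
  define k where "k = \<lfloor>real_of_ereal (drift b z)\<rfloor>"
  \<comment> \<open>The increment is an integer here, so the floor in \<open>walk\<close> changes
    only the type.\<close>
  have "real_of_int k = real_of_ereal (drift b z)" using m0(2) by (simp add: k_def)
  then have "drift b z = ereal (real_of_int k)" using drift_finite[of "real b" z] ez by simp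
  with att have "ereal (real_of_int k) = min (z m) (ereal b) - ereal (real m)" by simp
  then have eq: "ereal (real_of_int (k + int m)) = min (z m) (ereal b)"
    by (cases "min (z m) (ereal (real b))") auto
  have "ereal (real_of_int (k + int m)) \<le> ereal (real b)" "ereal (real_of_int (k + int m)) \<le> z m"
    unfolding eq by auto
  moreover have "z m = g (n, w + s - int m)" by (simp add: z_def downward_def)
  ultimately show ?thesis using that[of m] step ws by (auto simp: k_def)
qed

text \<open>The sum is \<open>d * n * (n + 1) / 2 - a * n\<close>; completing the square gives the
  bound.\<close>

lemma quadratic_sum_lower:
  fixes d a :: real
  assumes "0 < d" "0 \<le> a"
  shows "- a\<^sup>2 / (2 * d) \<le> (\<Sum>i=1..n. d * real i - a)"
proof -
  have gauss: "(\<Sum>i=1..n. d * real i - a) = d * (real n * (real n + 1) / 2) - a * real n"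
    by (induction n) (auto simp: field_simps)
  have "0 \<le> (d * real n - a)\<^sup>2" by simp
  then have "- a\<^sup>2 \<le> 2 * d * (d * (real n * real n / 2) - a * real n)"
    by (simp add: power2_eq_square algebra_simps)
  then have "- a\<^sup>2 / (2 * d) \<le> d * (real n * real n / 2) - a * real n"
    using assms by (simp add: field_simps)
  also have "\<dots> \<le> d * (real n * (real n + 1) / 2) - a * real n"
    using assms by (simp add: field_simps)
  finally show ?thesis using gauss by simp
qed

text \<open>The heights of the walk serve as \<open>v\<close>. Their increments are at least
  \<open>d * n - (c + b)\<close> at step \<open>n\<close>, so the total descent from
  \<open>K\<close> is at most \<open>(c + b)\<^sup>2 / (2 * d)\<close>. The first step does not go
  up because the initial slope is 0.\<close>

lemma walk_supersolution:
  fixes b :: nat and d c :: real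
  assumes val: "\<And>p. g p \<in> int_or_minf" and ex: "\<And>i u. \<exists>m. 0 \<le> downward g i u m"
    and slope: "\<And>n. d * real n - c \<le> real_of_int (snd (walk b g K n))"
    and d: "0 < d" and c: "0 \<le> c" and K: "(c + real b)\<^sup>2 / (2 * d) \<le> real_of_int K"
  shows "\<exists>v :: nat \<Rightarrow> int. v 0 = K \<and> v 1 \<le> K \<and> (\<forall>n. 0 \<le> v n) \<and>
    (\<forall>n. ereal (real_of_int (v (n + 2) + v n - 2 * v (n + 1))) \<le> g (n, v (n + 1)))"
proof -
  define v where "v n = fst (walk b g K n)" for n
  define s where "s n = snd (walk b g K n)" for n
  have "\<exists>m::nat. v (Suc n) = v n + s n - int m \<and> s (Suc n) - s n + int m \<le> int b \<and>
      ereal (real_of_int (s (Suc n) - s n + int m)) \<le> g (n, v (Suc n))" for n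
    unfolding v_def s_def by (rule walk_step[OF val ex, of b K n]) blast
  then obtain m :: "nat \<Rightarrow> nat" where m: "\<And>n. v (Suc n) = v n + s n - int (m n)"
    "\<And>n. s (Suc n) - s n + int (m n) \<le> int b"
    "\<And>n. ereal (real_of_int (s (Suc n) - s n + int (m n))) \<le> g (n, v (Suc n))"
    by metis
  have v0: "v 0 = K" "s 0 = 0" by (simp_all add: v_def s_def)
  have "real_of_int K + (\<Sum>i=1..n. d * real i - (c + real b)) \<le> real_of_int (v n)" for n
  proof (induction n)
    case (Suc n)
    \<comment> \<open>The bound \<open>s (Suc n) - s n + m n \<le> b\<close> trades the unknown
      undershoot for the next slope and the constant \<open>b\<close>.\<close>
    have "v n + s (Suc n) - int b \<le> v (Suc n)" using m(1,2)[of n] by simp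
    then have "real_of_int (v n) + real_of_int (s (Suc n)) - real b \<le> real_of_int (v (Suc n))"
      by linarith
    with Suc slope[of "Suc n"] show ?case by (simp add: s_def)
  qed (simp add: v0)
  moreover have "- (c + real b)\<^sup>2 / (2 * d) \<le> (\<Sum>i=1..n. d * real i - (c + real b))" for n
    using d c by (intro quadratic_sum_lower) auto
  ultimately have "0 \<le> real_of_int (v n)" for n using K by (smt (verit) minus_divide_left)
  then have "0 \<le> v n" for n by simp
  moreover have "ereal (real_of_int (v (n + 2) + v n - 2 * v (n + 1))) \<le> g (n, v (n + 1))" for n
  proof -
    \<comment> \<open>The undershoot at the next column only lowers the second difference, so it is
      dropped.\<close>
    have "v (n + 2) + v n - 2 * v (n + 1) \<le> s (Suc n) - s n + int (m n)"
      using m(1)[of n] m(1)[of "Suc n"] by simp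
    then have "ereal (real_of_int (v (n + 2) + v n - 2 * v (n + 1)))
      \<le> ereal (real_of_int (s (Suc n) - s n + int (m n)))" by (simp only: ereal_less_eq of_int_le_iff)
    also have "\<dots> \<le> g (n, v (n + 1))" using m(3)[of n] by simp
    finally show ?thesis .
  qed
  moreover have "v 1 \<le> K" using m(1)[of 0] v0 by simp
  ultimately show ?thesis using v0 by blast
qed

section \<open>Measurability of the walk\<close>

lemma measurable_argdrift:
  assumes [measurable]: "\<And>m. (\<lambda>y. Z y m) \<in> borel_measurable M"
  shows "(\<lambda>y. argdrift b (Z y)) \<in> measurable M (count_space UNIV)"
proof -
  have "Measurable.pred M (\<lambda>y. drift b (Z y) = min (Z y m) (ereal b) - ereal (real m))" for m
    unfolding pred_def drift_def by (intro borel_measurable_eq) measurable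
  then show ?thesis unfolding argdrift_def by (rule measurable_Least)
qed

lemma measurable_downward:
  assumes "{i} \<times> UNIV \<subseteq> J"
  shows "(\<lambda>y. downward y i u m) \<in> borel_measurable (Pi\<^sub>M J (\<lambda>_. borel))"
  unfolding downward_def using assms by (intro measurable_component_singleton) auto

lemma measurable_drift_downward:
  assumes "{i} \<times> UNIV \<subseteq> J"
  shows "(\<lambda>y. drift b (downward y i u)) \<in> borel_measurable (Pi\<^sub>M J (\<lambda>_. borel))"
  unfolding drift_def
  by (intro borel_measurable_SUP borel_measurable_ereal_diff borel_measurable_min
      measurable_downward[OF assms] measurable_const) auto

text \<open>Column \<open>n\<close> is entered at a random height, but the state has countably many
  values, so measurability reduces to a fixed state \<open>p\<close>. A general \<open>J\<close>
  covers both the past columns and the whole field.\<close>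

lemma measurable_walk:
  assumes "{..<n} \<times> UNIV \<subseteq> J"
  shows "(\<lambda>y. walk b y K n) \<in> measurable (Pi\<^sub>M J (\<lambda>_. borel)) (count_space UNIV)"
  using assms
proof (induction n)
  case (Suc n)
  have sub: "{n} \<times> UNIV \<subseteq> J" "{..<n} \<times> UNIV \<subseteq> J" using Suc.prems by auto
  define step where "step p y = (fst p + snd p - int (argdrift b (downward y n (fst p + snd p))),
       snd p + \<lfloor>real_of_ereal (drift b (downward y n (fst p + snd p)))\<rfloor>)" for p :: "int \<times> int" and y
  have "(\<lambda>y. step (walk b y K n) y) \<in> measurable (Pi\<^sub>M J (\<lambda>_. borel)) (count_space UNIV)"
  proof (rule measurable_compose_countable[where f=step and g="\<lambda>y. walk b y K n"])
    fix p
    define A where "A y = argdrift b (downward y n (fst p + snd p))" for y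
    define B where "B y = drift b (downward y n (fst p + snd p))" for y
    have [measurable]: "A \<in> measurable (Pi\<^sub>M J (\<lambda>_. borel)) (count_space UNIV)"
      unfolding A_def[abs_def] by (intro measurable_argdrift measurable_downward[OF sub(1)])
    have [measurable]: "B \<in> borel_measurable (Pi\<^sub>M J (\<lambda>_. borel))"
      unfolding B_def[abs_def] by (rule measurable_drift_downward[OF sub(1)])
    show "step p \<in> measurable (Pi\<^sub>M J (\<lambda>_. borel)) (count_space UNIV)"
      unfolding step_def[abs_def] A_def[symmetric] B_def[symmetric] by measurable
  qed (rule Suc.IH[OF sub(2)])
  moreover have "(\<lambda>y. step (walk b y K n) y) = (\<lambda>y. walk b y K (Suc n))"
    by (simp add: step_def Let_def case_prod_beta)
  ultimately show ?case by (simp only:)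
qed simp

section \<open>Half-lines\<close>

text \<open>Interpreted twice, for the columns right and left of column 0, in each case numbered
  outwards.\<close>

locale obstacle_field = prob_space M + law: obstacle_law D
  for M :: "'a measure" and D :: "ereal measure" +
  fixes F :: "nat \<times> int \<Rightarrow> 'a \<Rightarrow> ereal"
  assumes F_indep: "indep_vars (\<lambda>_. borel) F UNIV"
    and F_distr: "\<And>p. distr M borel (F p) = D"
    and F_values: "\<And>p \<omega>. \<omega> \<in> space M \<Longrightarrow> F p \<omega> \<in> int_or_minf"
begin

abbreviation field :: "'a \<Rightarrow> nat \<times> int \<Rightarrow> ereal" where
  "field \<omega> \<equiv> \<lambda>p. F p \<omega>"

lemma F_measurable [measurable]: "F p \<in> borel_measurable M"
  using F_indep unfolding indep_vars_def by blast

lemma field_measurable: "field \<in> measurable M (Pi\<^sub>M UNIV (\<lambda>_. borel))"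
  by (rule measurable_PiM_single') auto

lemma downward_indep: "indep_vars (\<lambda>_. borel) (\<lambda>m \<omega>. downward (field \<omega>) i u m) UNIV"
proof -
  have "inj (\<lambda>m. (i, u - int m))" by (auto simp: inj_def)
  from indep_vars_reindex_inj[OF F_indep this] show ?thesis by (simp add: downward_def)
qed

lemma downward_distr: "distr M borel (\<lambda>\<omega>. downward (field \<omega>) i u m) = D"
  by (simp add: downward_def F_distr)

lemmas downward_iid = prob_space_axioms downward_indep downward_distr

lemma AE_ex_nonneg: "AE \<omega> in M. \<forall>i u. \<exists>m. 0 \<le> downward (field \<omega>) i u m"
  using law.iid_sequence_AE_nonneg[OF downward_iid] by (simp add: AE_all_countable)

section \<open>Independence of the next column from the past\<close>

lemma nn_integral_downward:
  assumes "\<phi> \<in> borel_measurable law.column"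
  shows "(\<integral>\<^sup>+ \<omega>. \<phi> (downward (field \<omega>) i u) \<partial>M) = (\<integral>\<^sup>+ z. \<phi> z \<partial>law.column)"
  using nn_integral_distr[OF law.iid_sequence_measurable[OF downward_iid], of \<phi> i u] assms
  unfolding law.distr_iid_sequence[OF downward_iid] by simp

abbreviation past :: "nat \<Rightarrow> (nat \<times> int) set" where
  "past n \<equiv> {..<n} \<times> UNIV"

text \<open>Conditioning on the value \<open>u\<close> of \<open>U\<close>: for fixed
  \<open>u\<close> the increment depends only on column \<open>n\<close>, which is independent of
  the past, and its law does not depend on \<open>u\<close>. Summation over \<open>u\<close>
  restores the past factor.\<close>

lemma nn_integral_past_times_downward:
  fixes h :: "(nat \<times> int \<Rightarrow> ereal) \<Rightarrow> ennreal" and \<psi> :: "ereal \<Rightarrow> ennreal"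
  assumes h: "h \<in> borel_measurable (Pi\<^sub>M (past n) (\<lambda>_. borel))"
    and U: "U \<in> measurable (Pi\<^sub>M (past n) (\<lambda>_. borel)) (count_space UNIV)"
    and \<psi>: "\<psi> \<in> borel_measurable borel"
  shows "(\<integral>\<^sup>+ \<omega>. h (restrict (field \<omega>) (past n)) *
       \<psi> (drift b (downward (field \<omega>) n (U (restrict (field \<omega>) (past n))))) \<partial>M)
     = (\<integral>\<^sup>+ \<omega>. h (restrict (field \<omega>) (past n)) \<partial>M) * (\<integral>\<^sup>+ z. \<psi> (drift b z) \<partial>law.column)"
    (is "?L = _ * ?k")
proof -
  define R where "R \<omega> = restrict (field \<omega>) (past n)" for \<omega>
  have R [measurable]: "R \<in> measurable M (Pi\<^sub>M (past n) (\<lambda>_. borel))"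
    unfolding R_def[abs_def] by (intro measurable_restrict) auto
  define A where "A u y = h y * indicator {u} (U y)" for u and y :: "nat \<times> int \<Rightarrow> ereal"
  define C where "C u y = \<psi> (drift b (downward y n u))" for u and y :: "nat \<times> int \<Rightarrow> ereal"
  have A [measurable]: "A u \<in> borel_measurable (Pi\<^sub>M (past n) (\<lambda>_. borel))" for u
    unfolding A_def[abs_def]
    using h measurable_compose[OF U, of "indicator {u} :: int \<Rightarrow> ennreal"] by measurable
  have C: "C u \<in> borel_measurable (Pi\<^sub>M J (\<lambda>_. borel))" if "{n} \<times> UNIV \<subseteq> J" for u J
    unfolding C_def[abs_def] using \<psi> measurable_drift_downward[OF that] by (rule measurable_compose[rotated])
  have CM [measurable]: "(\<lambda>\<omega>. C u (field \<omega>)) \<in> borel_measurable M" for u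
    by (rule measurable_compose[OF field_measurable C]) auto
  \<comment> \<open>Two disjoint blocks of sites, indexed by \<open>bool\<close>: the past and
    column \<open>n\<close>.\<close>
  define K where "K = (\<lambda>c. if c then past n else {n} \<times> (UNIV :: int set))"
  define Y where "Y u = (\<lambda>c. if c then A u else C u)" for u
  have dis: "disjoint_family_on K UNIV" by (auto simp: disjoint_family_on_def K_def)
  have prod: "(\<integral>\<^sup>+ \<omega>. A u (R \<omega>) * C u (field \<omega>) \<partial>M)
     = (\<integral>\<^sup>+ \<omega>. A u (R \<omega>) \<partial>M) * ?k" for u
  proof -
    have "indep_vars (\<lambda>c. Pi\<^sub>M (K c) (\<lambda>_. borel)) (\<lambda>c \<omega>. restrict (field \<omega>) (K c)) UNIV"
      by (rule indep_vars_restrict[OF F_indep _ dis]) simp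
    then have ind: "indep_vars (\<lambda>_. borel) (\<lambda>c \<omega>. Y u c (restrict (field \<omega>) (K c))) UNIV"
      by (rule indep_vars_compose2) (use A C in \<open>auto simp: Y_def K_def\<close>)
    have "(\<integral>\<^sup>+ \<omega>. (\<Prod>c\<in>UNIV. Y u c (restrict (field \<omega>) (K c))) \<partial>M)
       = (\<Prod>c\<in>UNIV. \<integral>\<^sup>+ \<omega>. Y u c (restrict (field \<omega>) (K c)) \<partial>M)"
      by (rule indep_vars_nn_integral[OF _ ind]) auto
    moreover have "C u (restrict (field \<omega>) ({n} \<times> UNIV)) = C u (field \<omega>)" for \<omega>
      by (simp add: C_def downward_def[abs_def])
    ultimately have "(\<integral>\<^sup>+ \<omega>. A u (R \<omega>) * C u (field \<omega>) \<partial>M)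
       = (\<integral>\<^sup>+ \<omega>. A u (R \<omega>) \<partial>M) * (\<integral>\<^sup>+ \<omega>. C u (field \<omega>) \<partial>M)"
      by (simp add: UNIV_bool Y_def K_def R_def mult.commute)
    also have "(\<integral>\<^sup>+ \<omega>. C u (field \<omega>) \<partial>M) = ?k"
      unfolding C_def by (rule nn_integral_downward) (rule measurable_compose[OF law.measurable_drift \<psi>])
    finally show ?thesis .
  qed
  \<comment> \<open>Integration against counting measure is the sum over starting heights; the
    indicator in \<open>A\<close> keeps only \<open>u = U y\<close>.\<close>
  have sum: "(\<integral>\<^sup>+ u. A u y * c u \<partial>count_space UNIV) = h y * c (U y)" for y c
  proof -
    have "(\<integral>\<^sup>+ u. A u y * c u \<partial>count_space UNIV) =
       (\<integral>\<^sup>+ u. (h y * c (U y)) * indicator {U y} u \<partial>count_space UNIV)"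
      by (intro nn_integral_cong) (auto simp: A_def indicator_def)
    then show ?thesis by (simp add: nn_integral_cmult_indicator)
  qed
  have "?L = (\<integral>\<^sup>+ \<omega>. (\<integral>\<^sup>+ u. A u (R \<omega>) * C u (field \<omega>) \<partial>count_space UNIV) \<partial>M)"
    unfolding sum by (simp add: C_def R_def)
  also have "\<dots> = (\<integral>\<^sup>+ u. (\<integral>\<^sup>+ \<omega>. A u (R \<omega>) * C u (field \<omega>) \<partial>M) \<partial>count_space UNIV)"
    by (rule nn_integral_count_space_nn_integral) auto
  also have "\<dots> = (\<integral>\<^sup>+ u. (\<integral>\<^sup>+ \<omega>. A u (R \<omega>) \<partial>M) \<partial>count_space UNIV) * ?k"
    unfolding prod by (rule nn_integral_multc) simp
  also have "(\<integral>\<^sup>+ u. (\<integral>\<^sup>+ \<omega>. A u (R \<omega>) \<partial>M) \<partial>count_space UNIV)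
      = (\<integral>\<^sup>+ \<omega>. (\<integral>\<^sup>+ u. A u (R \<omega>) \<partial>count_space UNIV) \<partial>M)"
    by (rule nn_integral_count_space_nn_integral[symmetric]) auto
  also have "\<dots> = (\<integral>\<^sup>+ \<omega>. h (R \<omega>) \<partial>M)"
    using sum[of _ "\<lambda>_. 1"] by simp
  finally show ?thesis by (simp only: R_def)
qed

section \<open>Chernoff bound for the slope\<close>

lemma walk_measurable [measurable]:
  "(\<lambda>\<omega>. walk b (field \<omega>) K n) \<in> measurable M (count_space UNIV)"
  by (rule measurable_compose[OF field_measurable measurable_walk]) auto

text \<open>Each new column contributes an independent factor with mean \<open>k\<close>, although
  it is entered at a height that depends on the past.\<close>

lemma nn_integral_exp_walk:
  fixes b :: nat and s d :: real
  assumes k: "(\<integral>\<^sup>+ z. ennreal (exp (- s * (real_of_ereal (drift b z) - d))) \<partial>law.column) = ennreal k"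
    and k0: "0 \<le> k"
  shows "(\<integral>\<^sup>+ \<omega>. ennreal (exp (- s * (real_of_int (snd (walk b (field \<omega>) K n)) - d * real n))) \<partial>M)
    = ennreal (k ^ n)"
proof (induction n)
  case 0
  show ?case by (simp add: emeasure_space_1)
next
  case (Suc n)
  define h where "h y = ennreal (exp (- s * (real_of_int (snd (walk b y K n)) - d * real n)))" for y
  define U where "U y = fst (walk b y K n) + snd (walk b y K n)" for y
  define \<psi> where "\<psi> x = ennreal (exp (- s * (real_of_ereal x - d)))" for x
  have walk_past:
    "(\<lambda>y. walk b y K n) \<in> measurable (Pi\<^sub>M (past n) (\<lambda>_. borel)) (count_space UNIV)"
    by (rule measurable_walk) simp
  have r: "walk b (restrict (field \<omega>) (past n)) K n = walk b (field \<omega>) K n" for \<omega>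
    by (rule walk_cong) simp
  have rU: "U (restrict (field \<omega>) (past n)) = U (field \<omega>)" for \<omega>
    unfolding U_def r ..
  have "(\<integral>\<^sup>+ \<omega>. ennreal (exp (- s * (real_of_int (snd (walk b (field \<omega>) K (Suc n))) - d * real (Suc n)))) \<partial>M)
     = (\<integral>\<^sup>+ \<omega>. h (restrict (field \<omega>) (past n)) *
       \<psi> (drift b (downward (field \<omega>) n (U (restrict (field \<omega>) (past n))))) \<partial>M)"
  proof (rule nn_integral_cong_AE)
    show "AE \<omega> in M. ennreal (exp (- s * (real_of_int (snd (walk b (field \<omega>) K (Suc n))) - d * real (Suc n))))
     = h (restrict (field \<omega>) (past n)) *
       \<psi> (drift b (downward (field \<omega>) n (U (restrict (field \<omega>) (past n)))))"
      using AE_ex_nonneg AE_space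
    proof eventually_elim
      case (elim \<omega>)
      let ?z = "downward (field \<omega>) n (U (field \<omega>))"
      let ?d = "real_of_ereal (drift b ?z)"
      have "?d \<in> \<int>"
        by (rule drift_attained[of "real b" ?z])
           (use elim F_values in \<open>auto simp: downward_def\<close>)
      then have "real_of_int (snd (walk b (field \<omega>) K (Suc n))) = real_of_int (snd (walk b (field \<omega>) K n)) + ?d"
        by (simp add: Let_def case_prod_beta U_def)
      then have "- s * (real_of_int (snd (walk b (field \<omega>) K (Suc n))) - d * real (Suc n))
        = - s * (real_of_int (snd (walk b (field \<omega>) K n)) - d * real n) + - s * (?d - d)"
        by (simp add: algebra_simps)
      then have "exp (- s * (real_of_int (snd (walk b (field \<omega>) K (Suc n))) - d * real (Suc n)))
        = exp (- s * (real_of_int (snd (walk b (field \<omega>) K n)) - d * real n)) * exp (- s * (?d - d))"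
        by (simp only: exp_add)
      then show ?case unfolding h_def \<psi>_def rU r by (simp only: ennreal_mult exp_ge_zero)
    qed
  qed
  also have "\<dots> = (\<integral>\<^sup>+ \<omega>. h (restrict (field \<omega>) (past n)) \<partial>M) * (\<integral>\<^sup>+ z. \<psi> (drift b z) \<partial>law.column)"
  proof (rule nn_integral_past_times_downward)
    show "h \<in> borel_measurable (Pi\<^sub>M (past n) (\<lambda>_. borel))"
      unfolding h_def[abs_def] by (rule measurable_compose[OF walk_past]) simp
    show "U \<in> measurable (Pi\<^sub>M (past n) (\<lambda>_. borel)) (count_space UNIV)"
      unfolding U_def[abs_def] by (rule measurable_compose[OF walk_past]) simp
    show "\<psi> \<in> borel_measurable borel" unfolding \<psi>_def[abs_def] by measurable
  qed
  also have "\<dots> = ennreal (k ^ n) * ennreal k"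
    using Suc.IH k by (simp add: h_def \<psi>_def r)
  also have "\<dots> = ennreal (k ^ Suc n)"
    using k0 by (simp add: ennreal_mult' mult.commute)
  finally show ?case .
qed

text \<open>For each \<open>n\<close> the exponential Markov inequality bounds the probability by
  \<open>exp (- s * c) * k ^ n\<close>; the union bound sums a geometric series.\<close>

lemma prob_walk_slope:
  fixes b :: nat and s d c k :: real
  assumes k: "(\<integral>\<^sup>+ z. ennreal (exp (- s * (real_of_ereal (drift b z) - d))) \<partial>law.column) = ennreal k"
    and k01: "0 \<le> k" "k < 1" and s: "0 < s"
  shows "prob {\<omega> \<in> space M. \<exists>n. real_of_int (snd (walk b (field \<omega>) K n)) < d * real n - c}
     \<le> exp (- s * c) / (1 - k)"
proof -
  define E where "E n = {\<omega> \<in> space M. real_of_int (snd (walk b (field \<omega>) K n)) < d * real n - c}" for n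
  have [measurable]: "E n \<in> events" for n unfolding E_def by measurable
  have "emeasure M (E n) \<le> ennreal (exp (- s * c) * k ^ n)" for n
  proof -
    have "emeasure M (E n) = (\<integral>\<^sup>+ \<omega>. indicator (E n) \<omega> \<partial>M)" by simp
    also have "\<dots> \<le> (\<integral>\<^sup>+ \<omega>. ennreal (exp (- s * c)) *
      ennreal (exp (- s * (real_of_int (snd (walk b (field \<omega>) K n)) - d * real n))) \<partial>M)"
    proof (rule nn_integral_mono)
      fix \<omega>
      let ?x = "real_of_int (snd (walk b (field \<omega>) K n))"
      show "indicator (E n) \<omega> \<le> ennreal (exp (- s * c)) * ennreal (exp (- s * (?x - d * real n)))"
      proof (cases "\<omega> \<in> E n")
        case True
        then have "?x + c - d * real n \<le> 0" by (simp add: E_def)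
        then have "0 \<le> - s * c + - s * (?x - d * real n)"
          using mult_left_mono[of "?x + c - d * real n" 0 s] s by (simp add: algebra_simps)
        then have "1 \<le> exp (- s * c) * exp (- s * (?x - d * real n))"
          unfolding exp_add[symmetric] by (simp only: one_le_exp_iff)
        then have "ennreal 1 \<le> ennreal (exp (- s * c) * exp (- s * (?x - d * real n)))"
          by (rule ennreal_leI)
        then show ?thesis using True by (simp add: ennreal_mult)
      qed simp
    qed
    also have "\<dots> = ennreal (exp (- s * c)) * ennreal (k ^ n)"
      unfolding nn_integral_exp_walk[OF k k01(1), of K n, symmetric] by (rule nn_integral_cmult) measurable
    finally show ?thesis using k01 by (simp add: ennreal_mult)
  qed
  then have En: "prob (E n) \<le> exp (- s * c) * k ^ n" for n
    using k01 by (simp add: emeasure_eq_measure)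
  have sumk: "(\<lambda>n. exp (- s * c) * k ^ n) sums (exp (- s * c) * (1 / (1 - k)))"
    by (rule sums_mult, rule geometric_sums) (use k01 in simp)
  have sumE: "summable (\<lambda>n. prob (E n))"
    by (rule summable_comparison_test'[OF sums_summable[OF sumk], of 0]) (use En in auto)
  have "{\<omega> \<in> space M. \<exists>n. real_of_int (snd (walk b (field \<omega>) K n)) < d * real n - c} = (\<Union>n. E n)"
    by (auto simp: E_def)
  then have "prob {\<omega> \<in> space M. \<exists>n. real_of_int (snd (walk b (field \<omega>) K n)) < d * real n - c}
     \<le> (\<Sum>n. prob (E n))"
    using finite_measure_subadditive_countably[of E, OF _ sumE] by (auto simp: image_subset_iff)
  also have "\<dots> \<le> (\<Sum>n. exp (- s * c) * k ^ n)"
    by (rule suminf_le[OF En sumE sums_summable[OF sumk]])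
  also have "\<dots> = exp (- s * c) / (1 - k)" using sums_unique[OF sumk] by simp
  finally show ?thesis .
qed

text \<open>Position \<open>n + 1\<close> of \<open>v\<close> is constrained by column
  \<open>n\<close> of \<open>F\<close>, as position 0 lies in the central column. The condition
  \<open>v 1 \<le> K\<close> prepares the gluing there.\<close>

definition half_line_supersolution :: "int \<Rightarrow> (nat \<Rightarrow> int) \<Rightarrow> 'a \<Rightarrow> bool" where
  "half_line_supersolution K v \<omega> \<longleftrightarrow> v 0 = K \<and> v 1 \<le> K \<and> (\<forall>n. 0 \<le> v n) \<and>
    (\<forall>n. ereal (real_of_int (v (n + 2) + v n - 2 * v (n + 1))) \<le> F (n, v (n + 1)) \<omega>)"

text \<open>The constant \<open>c\<close> is fixed by the tolerance \<open>e\<close> before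
  \<open>K\<close> is chosen, and the slope estimate holds for every \<open>K\<close>. Only
  nonnegativity of the heights needs \<open>K\<close> large.\<close>

lemma half_line_supersolution_likely:
  assumes pos: "(\<integral>\<^sup>+ z. e2ennreal (- (SUP m. z m - ereal (real m))) \<partial>law.column)
       < (\<integral>\<^sup>+ z. e2ennreal (SUP m. z m - ereal (real m)) \<partial>law.column)"
    and e: "0 < e"
  shows "\<exists>K0. \<forall>K\<ge>K0. \<exists>Bad\<in>events. prob Bad \<le> e \<and>
    (\<forall>\<omega>\<in>space M - Bad. \<exists>v. half_line_supersolution K v \<omega>)"
proof -
  obtain b :: nat and d s k where k: "0 < d" "0 < s" "0 \<le> k" "k < 1"
     "(\<integral>\<^sup>+ z. ennreal (exp (- s * (real_of_ereal (drift (real b) z) - d))) \<partial>law.column) = ennreal k"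
    using law.ex_exp_drift_less_1[OF pos] by blast
  \<comment> \<open>Chosen so that \<open>exp (- s * c) \<le> e * (1 - k)\<close>, which makes the
    slope bound at most \<open>e\<close>.\<close>
  define c where "c = max 0 (- ln (e * (1 - k)) / s)"
  have c: "0 \<le> c" by (simp add: c_def)
  have "- ln (e * (1 - k)) \<le> s * c" using k(2) by (simp add: c_def max_def field_simps)
  then have "exp (- s * c) \<le> exp (ln (e * (1 - k)))" by simp
  then have small: "exp (- s * c) / (1 - k) \<le> e" using k e by (simp add: field_simps)
  obtain N where N: "N \<in> null_sets M"
    "{\<omega> \<in> space M. \<not> (\<forall>i u. \<exists>m. 0 \<le> downward (field \<omega>) i u m)} \<subseteq> N"
    using AE_ex_nonneg by (auto elim!: AE_E simp: null_sets_def)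
  have "\<exists>Bad\<in>events. prob Bad \<le> e \<and> (\<forall>\<omega>\<in>space M - Bad. \<exists>v. half_line_supersolution K v \<omega>)"
    if K: "K \<ge> \<lceil>(c + real b)\<^sup>2 / (2 * d)\<rceil>" for K
  proof (intro bexI conjI ballI)
    let ?S = "{\<omega> \<in> space M. \<exists>n. real_of_int (snd (walk b (field \<omega>) K n)) < d * real n - c}"
    have S: "?S \<in> events" by measurable
    then show "?S \<union> N \<in> events" using N by auto
    have "prob (?S \<union> N) = prob ?S" using S N(1) by (rule measure_Un_null_set)
    also have "\<dots> \<le> e" using prob_walk_slope[OF k(5,3,4,2), of K c] small by linarith
    finally show "prob (?S \<union> N) \<le> e" .
    fix \<omega> assume \<omega>: "\<omega> \<in> space M - (?S \<union> N)"
    then have "\<And>n. d * real n - c \<le> real_of_int (snd (walk b (field \<omega>) K n))"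
      by (auto simp: not_less)
    moreover have "\<And>i u. \<exists>m. 0 \<le> downward (field \<omega>) i u m" using \<omega> N(2) by blast
    moreover have "(c + real b)\<^sup>2 / (2 * d) \<le> real_of_int K" using K by (simp add: ceiling_le_iff)
    ultimately show "\<exists>v. half_line_supersolution K v \<omega>"
      unfolding half_line_supersolution_def
      using walk_supersolution[of "field \<omega>" d c b K] F_values \<omega> k(1) c by blast
  qed
  then show ?thesis by blast
qed

end

section \<open>Gluing the half-lines\<close>

text \<open>At the centre the second difference is \<open>(vR 1 - K) + (vL 1 - K)\<close>, which is
  at most 0 and so at most \<open>g 0 K\<close>. Away from it each site involves only one of the two
  half-lines.\<close>

lemma glue_half_lines:
  fixes g :: "int \<Rightarrow> int \<Rightarrow> ereal" and vR vL :: "nat \<Rightarrow> int"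
  assumes R: "vR 0 = K" "vR 1 \<le> K" "\<And>n. 0 \<le> vR n"
    "\<And>n. ereal (real_of_int (vR (n + 2) + vR n - 2 * vR (n + 1))) \<le> g (int n + 1) (vR (n + 1))"
    and L: "vL 0 = K" "vL 1 \<le> K" "\<And>n. 0 \<le> vL n"
    "\<And>n. ereal (real_of_int (vL (n + 2) + vL n - 2 * vL (n + 1))) \<le> g (- int n - 1) (vL (n + 1))"
    and g0: "0 \<le> g 0 K"
  shows "\<exists>v :: int \<Rightarrow> nat. \<forall>i.
    ereal (real_of_int (laplacian1 (\<lambda>k. int (v k)) i)) \<le> g i (int (v i))"
proof -
  define u where "u i = (if 0 \<le> i then vR (nat i) else vL (nat (- i)))" for i
  have uR: "u (int n) = vR n" and uL: "u (- int n) = vL n" for n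
    using R(1) L(1) by (auto simp: u_def)
  have "ereal (real_of_int (u (i + 1) + u (i - 1) - 2 * u i)) \<le> g i (u i)" for i
  proof -
    consider "i = 0" | n where "i = int n + 1" | n where "i = - int n - 1"
    proof (cases "i = 0")
      case False
      have "i = int (nat (i - 1)) + 1 \<or> i = - int (nat (- i - 1)) - 1" using False by linarith
      then show ?thesis using that by blast
    qed
    then show ?thesis
    proof cases
      case 1
      have "u 1 \<le> K" "u (- 1) \<le> K" "u 0 = K"
        using uR[of 1] uL[of 1] uR[of 0] R(1,2) L(2) by simp_all
      then have "ereal (real_of_int (u (i + 1) + u (i - 1) - 2 * u i)) \<le> 0"
        using 1 by simp
      then show ?thesis using g0 1 \<open>u 0 = K\<close> by (metis order_trans)
    next
      case (2 n)
      then have "u (i + 1) = vR (n + 2)" "u (i - 1) = vR n" "u i = vR (n + 1)"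
        using uR[of "n + 2"] uR[of n] uR[of "n + 1"] by (simp_all add: add.commute)
      then show ?thesis using R(4)[of n] 2 by simp
    next
      case (3 n)
      then have "i - 1 = - int (n + 2)" "i + 1 = - int n" "i = - int (n + 1)" by simp_all
      then have "u (i - 1) = vL (n + 2)" "u (i + 1) = vL n" "u i = vL (n + 1)"
        using uL by metis+
      then show ?thesis using L(4)[of n] 3 by (simp add: add.commute)
    qed
  qed
  moreover have "int (nat (u i)) = u i" for i using R(3) L(3) by (simp add: u_def)
  ultimately show ?thesis by (intro exI[of _ "\<lambda>i. nat (u i)"]) (simp add: laplacian1_def)
qed

text \<open>Partial sums of \<open>\<bar>k0 i\<bar> + 1\<close> work. Injectivity makes the chosen
  heights distinct sites of column 0, hence independent values.\<close>

lemma ex_injective_above: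
  fixes k0 :: "nat \<Rightarrow> int"
  obtains k :: "nat \<Rightarrow> int" where "inj k" "\<And>n. k0 n \<le> k n"
proof -
  define k where "k n = (\<Sum>i\<le>n. \<bar>k0 i\<bar> + 1)" for n
  have "strict_mono k" unfolding strict_mono_Suc_iff by (simp add: k_def)
  moreover have "k0 n \<le> k n" for n
  proof -
    have "k0 n \<le> \<bar>k0 n\<bar> + 1" by simp
    also have "\<dots> \<le> k n" unfolding k_def by (rule member_le_sum) auto
    finally show ?thesis .
  qed
  ultimately show ?thesis using that strict_mono_imp_inj_on by blast
qed

text \<open>Definedness excludes \<open>\<infinity> - \<infinity>\<close>, which would count as
  positive in \<open>ereal\<close>; otherwise a positive difference means strict inequality.\<close>

lemma ereal_expectation_posD:
  assumes "ereal_expectation_defined M X" "0 < ereal_expectation M X"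
  shows "(\<integral>\<^sup>+ x. e2ennreal (- X x) \<partial>M) < (\<integral>\<^sup>+ x. e2ennreal (X x) \<partial>M)"
proof -
  have *: "b < a"
    if "0 < enn2ereal a - enn2ereal b" "a < \<infinity> \<or> b < \<infinity>" for a b
    using that
  proof (cases a b rule: ennreal2_cases)
    case (real_real a' b')
    then show ?thesis using that by (simp add: ennreal_less_iff)
  qed (auto simp: top_ereal_def)
  show ?thesis
    using *[OF assms(2)[unfolded ereal_expectation_def]] assms(1)
    by (auto simp: ereal_expectation_defined_def)
qed

theorem theorem2p1:
  fixes M :: "'a measure" and f :: "int \<Rightarrow> int \<Rightarrow> 'a \<Rightarrow> ereal"
    and N :: "'b measure" and Z :: "nat \<Rightarrow> 'b \<Rightarrow> ereal"
  assumes "prob_space M" and "prob_space N"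
    and f_values: "\<And>i j \<omega>. \<omega> \<in> space M \<Longrightarrow> f i j \<omega> \<in> int_or_minf"
    and f_indep: "prob_space.indep_vars M (\<lambda>_. borel) (\<lambda>(i, j). f i j) (UNIV :: (int \<times> int) set)"
    and f_ident: "\<And>i j. distr M borel (f i j) = distr M borel (f 0 0)"
    and Z_indep: "prob_space.indep_vars N (\<lambda>_. borel) Z (UNIV :: nat set)"
    and Z_distr: "\<And>m. distr N borel (Z m) = distr M borel (f 0 0)"
    and E_defined: "ereal_expectation_defined N (\<lambda>\<omega>. SUP m. Z m \<omega> - ereal (real m))"
    and E_pos: "ereal_expectation N (\<lambda>\<omega>. SUP m. Z m \<omega> - ereal (real m)) > 0"
  shows "AE \<omega> in M. \<exists>v :: int \<Rightarrow> nat. \<forall>i.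
           ereal (real_of_int (laplacian1 (\<lambda>k. int (v k)) i)) \<le> f i (int (v i)) \<omega>"
proof -
  interpret M: prob_space M by fact
  interpret N: prob_space N by fact
  define D where "D = distr M borel (f 0 0)"
  have fD: "distr M borel (f i j) = D" for i j unfolding D_def by (rule f_ident)
  have ZD: "distr N borel (Z m) = D" for m unfolding D_def by (rule Z_distr)
  have "\<forall>p. (case p of (i, j) \<Rightarrow> f i j) \<in> borel_measurable M"
    using f_indep unfolding M.indep_vars_def by blast
  then have [measurable]: "f i j \<in> borel_measurable M" for i j by (auto dest: spec[of _ "(i, j)"])
  have [measurable]: "Z m \<in> borel_measurable N" for m
    using Z_indep unfolding N.indep_vars_def by blast
  have "prob_space D" unfolding D_def by (rule M.prob_space_distr) measurable
  then interpret D: prob_space D .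
  note E = ereal_expectation_posD[OF E_defined E_pos]
  \<comment> \<open>If almost surely all \<open>Z m\<close> were negative, the positive part of the
    supremum would vanish, contradicting \<open>E\<close>.\<close>
  have "D.prob {..<0} \<noteq> 1"
  proof
    assume "D.prob {..<0} = 1"
    then have ae: "AE x in D. x < 0" using D.AE_prob_1[of "{..<0}"] by simp
    have "AE \<omega> in N. Z m \<omega> < 0" for m
      by (rule AE_distrD[of "Z m" N borel]) (simp, unfold ZD, rule ae)
    then have "AE \<omega> in N. \<forall>m. Z m \<omega> < 0" by (simp add: AE_all_countable)
    then have "AE \<omega> in N. e2ennreal (SUP m. Z m \<omega> - ereal (real m)) = 0"
    proof eventually_elim
      case (elim \<omega>)
      have "Z m \<omega> - ereal (real m) \<le> 0" for m
        using elim[rule_format, of m] by (cases "Z m \<omega>") auto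
      then have "(SUP m. Z m \<omega> - ereal (real m)) \<le> 0" by (rule SUP_least)
      then show ?case by (rule e2ennreal_neg)
    qed
    then have "(\<integral>\<^sup>+ \<omega>. e2ennreal (SUP m. Z m \<omega> - ereal (real m)) \<partial>N) = (\<integral>\<^sup>+ \<omega>. 0 \<partial>N)"
      by (rule nn_integral_cong_AE)
    with E show False by simp
  qed
  then have "D.prob {..<0} < 1" using D.prob_le_1[of "{..<0}"] by linarith
  then interpret D: obstacle_law D by unfold_locales (simp_all add: D_def)
  have transfer: "(\<integral>\<^sup>+ \<omega>. \<phi> (SUP m. Z m \<omega> - ereal (real m)) \<partial>N)
      = (\<integral>\<^sup>+ z. \<phi> (SUP m. z m - ereal (real m)) \<partial>D.column)"
    if [measurable]: "\<phi> \<in> borel_measurable borel" for \<phi> :: "ereal \<Rightarrow> ennreal"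
  proof -
    have "(\<integral>\<^sup>+ z. \<phi> (SUP m. z m - ereal (real m)) \<partial>distr N D.column (\<lambda>\<omega> m. Z m \<omega>))
       = (\<integral>\<^sup>+ \<omega>. \<phi> (SUP m. Z m \<omega> - ereal (real m)) \<partial>N)"
      by (rule nn_integral_distr[OF D.iid_sequence_measurable[OF \<open>prob_space N\<close> Z_indep ZD]])
         measurable
    then show ?thesis
      unfolding D.distr_iid_sequence[OF \<open>prob_space N\<close> Z_indep ZD] by simp
  qed
  note E' = E[unfolded transfer[of "\<lambda>x. e2ennreal x", simplified] transfer[of "\<lambda>x. e2ennreal (- x)", simplified]]
  \<comment> \<open>Columns are numbered outwards and column 0 is left out.\<close>
  define FR where "FR = (\<lambda>(n, j). f (int n + 1) j)"
  define FL where "FL = (\<lambda>(n, j). f (- int n - 1) j)"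
  interpret R: obstacle_field M D FR
  proof
    have "inj (\<lambda>(n::nat, j::int). (int n + 1, j))" by (auto simp: inj_def)
    from M.indep_vars_reindex_inj[OF f_indep this] show "M.indep_vars (\<lambda>_. borel) FR UNIV"
      by (simp add: FR_def case_prod_beta')
  qed (auto simp: FR_def fD f_values split: prod.split)
  interpret L: obstacle_field M D FL
  proof
    have "inj (\<lambda>(n::nat, j::int). (- int n - 1, j))" by (auto simp: inj_def)
    from M.indep_vars_reindex_inj[OF f_indep this] show "M.indep_vars (\<lambda>_. borel) FL UNIV"
      by (simp add: FL_def case_prod_beta')
  qed (auto simp: FL_def fD f_values split: prod.split)
  \<comment> \<open>Stage \<open>n\<close> has tolerance \<open>(1/2) ^ n\<close>, so the failure
    probabilities are summable.\<close>
  have "\<exists>k0. \<forall>n::nat. \<forall>k\<ge>k0 n. \<exists>Bad\<in>M.events. M.prob Bad \<le> (1/2) ^ n \<and>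
      (\<forall>\<omega>\<in>space M - Bad. \<exists>v. R.half_line_supersolution k v \<omega>)"
    by (intro choice allI R.half_line_supersolution_likely[OF E']) simp
  then obtain kR where kR: "\<And>n k. kR n \<le> k \<Longrightarrow> \<exists>Bad\<in>M.events. M.prob Bad \<le> (1/2) ^ n \<and>
      (\<forall>\<omega>\<in>space M - Bad. \<exists>v. R.half_line_supersolution k v \<omega>)" by blast
  have "\<exists>k0. \<forall>n::nat. \<forall>k\<ge>k0 n. \<exists>Bad\<in>M.events. M.prob Bad \<le> (1/2) ^ n \<and>
      (\<forall>\<omega>\<in>space M - Bad. \<exists>v. L.half_line_supersolution k v \<omega>)"
    by (intro choice allI L.half_line_supersolution_likely[OF E']) simp
  then obtain kL where kL: "\<And>n k. kL n \<le> k \<Longrightarrow> \<exists>Bad\<in>M.events. M.prob Bad \<le> (1/2) ^ n \<and>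
      (\<forall>\<omega>\<in>space M - Bad. \<exists>v. L.half_line_supersolution k v \<omega>)" by blast
  obtain k where k: "inj k" "\<And>n. max (kR n) (kL n) \<le> k n"
    using ex_injective_above[of "\<lambda>n. max (kR n) (kL n)"] by blast
  have "\<forall>n. \<exists>Bad. Bad \<in> M.events \<and> M.prob Bad \<le> 2 * (1/2) ^ n \<and>
      (\<forall>\<omega>\<in>space M - Bad. (\<exists>v. R.half_line_supersolution (k n) v \<omega>) \<and> (\<exists>v. L.half_line_supersolution (k n) v \<omega>))"
  proof
    fix n
    obtain A B where A: "A \<in> M.events" "M.prob A \<le> (1/2) ^ n"
        "\<forall>\<omega>\<in>space M - A. \<exists>v. R.half_line_supersolution (k n) v \<omega>"
      and B: "B \<in> M.events" "M.prob B \<le> (1/2) ^ n"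
        "\<forall>\<omega>\<in>space M - B. \<exists>v. L.half_line_supersolution (k n) v \<omega>"
      using kR[of n "k n"] kL[of n "k n"] k(2)[of n] by auto
    have "M.prob (A \<union> B) \<le> 2 * (1/2) ^ n"
      using measure_Un_le[OF A(1) B(1)] A(2) B(2) by simp
    then show "\<exists>Bad. Bad \<in> M.events \<and> M.prob Bad \<le> 2 * (1/2) ^ n \<and>
      (\<forall>\<omega>\<in>space M - Bad. (\<exists>v. R.half_line_supersolution (k n) v \<omega>) \<and> (\<exists>v. L.half_line_supersolution (k n) v \<omega>))"
      using A B by (intro exI[of _ "A \<union> B"]) auto
  qed
  then obtain Bad where Bad: "\<And>n. Bad n \<in> M.events" "\<And>n. M.prob (Bad n) \<le> 2 * (1/2) ^ n"
    "\<And>n \<omega>. \<omega> \<in> space M - Bad n \<Longrightarrow> (\<exists>v. R.half_line_supersolution (k n) v \<omega>) \<and> (\<exists>v. L.half_line_supersolution (k n) v \<omega>)"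
    by metis
  have "summable (\<lambda>n. M.prob (Bad n))"
  proof (rule summable_comparison_test')
    show "summable (\<lambda>n. 2 * (1/2 :: real) ^ n)" by (intro summable_mult summable_geometric) simp
    show "norm (M.prob (Bad n)) \<le> 2 * (1/2) ^ n" if "0 \<le> n" for n using Bad(2)[of n] by simp
  qed
  then have good: "AE \<omega> in M. \<forall>\<^sub>F n in sequentially. \<omega> \<in> space M - Bad n"
    by (intro borel_cantelli_AE1 Bad(1)) (simp_all add: M.emeasure_eq_measure)
  \<comment> \<open>Beyond any index the values of column 0 at the chosen heights are iid, so one of
    them is nonnegative. The quantifier over \<open>n0\<close> stands inside the almost sure
    statement because the Borel--Cantelli index depends on \<open>\<omega>\<close>.\<close>
  have centre: "AE \<omega> in M. \<forall>n0. \<exists>m. 0 \<le> f 0 (k (n0 + m)) \<omega>"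
  proof -
    have "AE \<omega> in M. \<exists>m. 0 \<le> f 0 (k (n0 + m)) \<omega>" for n0
    proof (rule D.iid_sequence_AE_nonneg[OF \<open>prob_space M\<close>])
      have "inj (\<lambda>m. (0::int, k (n0 + m)))" using k(1) by (auto intro!: injI dest: injD)
      from M.indep_vars_reindex_inj[OF f_indep this]
      show "M.indep_vars (\<lambda>_. borel) (\<lambda>m. f 0 (k (n0 + m))) UNIV" by simp
    qed (rule fD)
    then show ?thesis by (simp add: AE_all_countable)
  qed
  from good centre show ?thesis
  proof eventually_elim
    case (elim \<omega>)
    then obtain n0 where n0: "\<And>n. n0 \<le> n \<Longrightarrow> \<omega> \<in> space M - Bad n"
      by (auto simp: eventually_sequentially)
    \<comment> \<open>This height lies beyond \<open>n0\<close>, so both half-lines exist there and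
      the central value is nonnegative.\<close>
    obtain m where m: "0 \<le> f 0 (k (n0 + m)) \<omega>" using elim(2) by blast
    obtain vR vL where vR: "R.half_line_supersolution (k (n0 + m)) vR \<omega>"
      and vL: "L.half_line_supersolution (k (n0 + m)) vL \<omega>"
      using Bad(3)[OF n0[of "n0 + m"]] by auto
    show ?case
      by (rule glue_half_lines[of vR "k (n0 + m)" "\<lambda>i j. f i j \<omega>" vL])
         (use vR[unfolded R.half_line_supersolution_def] vL[unfolded L.half_line_supersolution_def] m
          in \<open>auto simp: FR_def FL_def\<close>)
  qed
qed

end
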